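(* Let $D$ be a completely integrally closed integral domain. Then $\bigcap_{n=1}^{\infty}(I^n)_v=(0)$ for every ideal $I$ of $D$ with $I_v\subsetneq D$. In particular, a completely integrally closed domain is Archimedean.
   Context: $D$ has quotient field $K$. For a nonzero fractional ideal $I$ put $I^{-1}=\{x\in K\mid xI\subseteq D\}$ and $I_v=(I^{-1})^{-1}$ (ideals to which $v$ is applied are nonzero). $D$ is completely integrally closed if whenever $x\in K$ and $0\ne r\in D$ satisfy $rx^n\in D$ for every integer $n\ge 1$, then $x\in D$. $D$ is Archimedean if $\bigcap_{n=1}^{\infty}(x^n)=(0)$ for every nonunit $x\in D$. *)

theory Defs
  imports "HOL-Algebra.Algebra"
begin

text \<open>
  An integral domain with its quotient field is given by a field \<open>K\<close> and a subset \<open>D\<close> of its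
  carrier that is a subdomain and of which \<open>K\<close> is the set of all fractions. The domain, as a ring
  in its own right, is \<open>K\<lparr>carrier := D\<rparr>\<close>.
\<close>

locale quotient_field = field K + subdomain D K for D and K (structure) +
  assumes fraction: "x \<in> carrier K \<Longrightarrow> \<exists>a\<in>D. \<exists>b\<in>D - {\<zero>}. x = a \<otimes> inv b"

text \<open>
  The two operations below are total on subsets of \<open>K\<close>, but they are the usual ones only for
  nonzero fractional ideals \<open>I\<close> of \<open>D\<close>. For instance, the inverse of the zero ideal comes out
  as all of \<open>K\<close>.
\<close>

definition frac_inverse :: "('a, 'b) ring_scheme \<Rightarrow> 'a set \<Rightarrow> 'a set \<Rightarrow> 'a set"
  where "frac_inverse K D I = {x \<in> carrier K. \<forall>y\<in>I. x \<otimes>\<^bsub>K\<^esub> y \<in> D}"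

definition v_closure :: "('a, 'b) ring_scheme \<Rightarrow> 'a set \<Rightarrow> 'a set \<Rightarrow> 'a set"
  where "v_closure K D I = frac_inverse K D (frac_inverse K D I)"

definition completely_integrally_closed :: "('a, 'b) ring_scheme \<Rightarrow> 'a set \<Rightarrow> bool"
  where "completely_integrally_closed K D \<longleftrightarrow>
    (\<forall>x\<in>carrier K. \<forall>r\<in>D - {\<zero>\<^bsub>K\<^esub>}.
      (\<forall>n::nat. n \<ge> 1 \<longrightarrow> r \<otimes>\<^bsub>K\<^esub> x [^]\<^bsub>K\<^esub> n \<in> D) \<longrightarrow> x \<in> D)"

definition archimedean_ring :: "('a, 'b) ring_scheme \<Rightarrow> bool"
  where "archimedean_ring R \<longleftrightarrow>
    (\<forall>x\<in>carrier R - Units R. (\<Inter>n\<in>{1::nat..}. PIdl\<^bsub>R\<^esub> (x [^]\<^bsub>R\<^esub> n)) = {\<zero>\<^bsub>R\<^esub>})"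

end

theory Submission
  imports Defs
begin

text \<open>
  If \<open>I\<^sub>v \<noteq> D\<close>, then \<open>I\<inverse>\<close> contains some \<open>x\<close> outside \<open>D\<close>. As \<open>x\<^sup>n \<in> (I\<^sup>n)\<inverse>\<close>, every \<open>r\<close> in all the
  \<open>(I\<^sup>n)\<^sub>v\<close> satisfies \<open>r x\<^sup>n \<in> D\<close> for all \<open>n \<ge> 1\<close>, so complete integral closedness forces \<open>r = 0\<close>. The
  same argument with the inverse of a nonzero nonunit in place of \<open>x\<close> gives the Archimedean property.
\<close>

context quotient_field
begin

lemma D_closed:
  "a \<in> D \<Longrightarrow> a \<in> carrier K" "\<zero> \<in> D" "\<one> \<in> D"
  "\<lbrakk> a \<in> D; b \<in> D \<rbrakk> \<Longrightarrow> a \<otimes> b \<in> D" "\<lbrakk> a \<in> D; b \<in> D \<rbrakk> \<Longrightarrow> a \<oplus> b \<in> D"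
  using subdomainE[OF subdomain_axioms] by auto

lemma ideal_subset_D: "ideal I (K\<lparr>carrier := D\<rparr>) \<Longrightarrow> I \<subseteq> D"
  using ideal.Icarr by fastforce

text \<open>On a generator, \<open>x \<otimes> y \<otimes> (i \<otimes> j)\<close> regroups as
  \<open>(x \<otimes> i) \<otimes> (y \<otimes> j)\<close>, a product of two elements of
  \<open>D\<close>; sums follow by distributivity.\<close>

lemma frac_inverse_mult_closed:
  assumes "I \<subseteq> D" "J \<subseteq> D" "x \<in> frac_inverse K D I" "y \<in> frac_inverse K D J"
  shows "x \<otimes> y \<in> frac_inverse K D (ideal_prod (K\<lparr>carrier := D\<rparr>) I J)"
proof -
  have xy: "x \<in> carrier K" "y \<in> carrier K"
    using assms(3,4) by (auto simp: frac_inverse_def)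
  \<comment> \<open>The conjunct \<open>z \<in> D\<close> strengthens the induction: distributivity
    in the sum case needs both summands in the carrier of \<open>K\<close>.\<close>
  have "z \<in> D \<and> x \<otimes> y \<otimes> z \<in> D" if "z \<in> ideal_prod (K\<lparr>carrier := D\<rparr>) I J" for z
    using that
  proof induction
    case (prod i j)
    then have ij: "i \<in> D" "j \<in> D" using assms(1,2) by auto
    have "x \<otimes> i \<in> D" "y \<otimes> j \<in> D"
      using prod assms(3,4) by (auto simp: frac_inverse_def)
    moreover have "x \<otimes> y \<otimes> (i \<otimes> j) = (x \<otimes> i) \<otimes> (y \<otimes> j)"
      using xy ij D_closed(1) by (simp add: m_ac)
    ultimately show ?case using D_closed(4) ij by simp
  next
    case (sum s t)
    then show ?case using xy D_closed(1,5) by (simp add: r_distr)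
  qed
  then show ?thesis using xy by (auto simp: frac_inverse_def)
qed

lemma frac_inverse_pow:
  assumes "ideal I (K\<lparr>carrier := D\<rparr>)" "x \<in> frac_inverse K D I"
  shows "x [^] n \<in> frac_inverse K D (I [^]\<^bsub>ideals_set (K\<lparr>carrier := D\<rparr>)\<^esub> (n::nat))"
proof -
  interpret R: ring "K\<lparr>carrier := D\<rparr>"
    using assms(1) by (rule ideal.axioms(2))
  \<comment> \<open>The ideal property is carried through the induction because the product lemma
    requires its factors to lie in \<open>D\<close>. The zeroth power is \<open>D\<close> itself,
    whose inverse contains \<open>\<one>\<close>.\<close>
  have "ideal (I [^]\<^bsub>ideals_set (K\<lparr>carrier := D\<rparr>)\<^esub> n) (K\<lparr>carrier := D\<rparr>)
      \<and> x [^] n \<in> frac_inverse K D (I [^]\<^bsub>ideals_set (K\<lparr>carrier := D\<rparr>)\<^esub> n)"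
  proof (induction n)
    case 0
    then show ?case
      using R.oneideal D_closed(1) by (simp add: ideals_set_def nat_pow_def frac_inverse_def)
  next
    case (Suc n)
    then show ?case
      using R.ideal_prod_is_ideal[OF _ assms(1)]
        frac_inverse_mult_closed[OF ideal_subset_D ideal_subset_D _ assms(2)] assms(1)
      by (simp add: ideals_set_def nat_pow_def)
  qed
  then show ?thesis by blast
qed

lemma Inter_v_closure_pow_eq_zero:
  assumes "completely_integrally_closed K D"
    and I: "ideal I (K\<lparr>carrier := D\<rparr>)" and v: "v_closure K D I \<subset> D"
  shows "(\<Inter>n\<in>{1::nat..}. v_closure K D (I [^]\<^bsub>ideals_set (K\<lparr>carrier := D\<rparr>)\<^esub> n)) = {\<zero>}"
proof (intro equalityI subsetI)
  \<comment> \<open>If the inverse of \<open>I\<close> lay in \<open>D\<close>, every element of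
    \<open>D\<close> would multiply it into \<open>D\<close>, so \<open>D\<close> would be contained
    in the v-closure of \<open>I\<close>, against properness.\<close>
  have "\<not> frac_inverse K D I \<subseteq> D"
  proof
    assume "frac_inverse K D I \<subseteq> D"
    then have "D \<subseteq> v_closure K D I"
      using D_closed(1,4) by (auto simp: v_closure_def frac_inverse_def[of K D "frac_inverse K D I"])
    with v show False by blast
  qed
  then obtain x where x: "x \<in> frac_inverse K D I" "x \<notin> D" by blast
  fix r
  assume r: "r \<in> (\<Inter>n\<in>{1::nat..}. v_closure K D (I [^]\<^bsub>ideals_set (K\<lparr>carrier := D\<rparr>)\<^esub> n))"
  have rx: "r \<otimes> x [^] n \<in> D" if "n \<ge> 1" for n :: nat
    using r frac_inverse_pow[OF I x(1), of n] that
    by (auto simp: v_closure_def frac_inverse_def[of K D "frac_inverse K D _"])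
  interpret R: ring "K\<lparr>carrier := D\<rparr>"
    using I by (rule ideal.axioms(2))
  \<comment> \<open>Complete integral closedness applies only to \<open>r\<close> in
    \<open>D\<close>. This comes from \<open>n = 1\<close>: the first power unfolds to the product
    of \<open>D\<close> and \<open>I\<close>, which lies in \<open>I\<close>, and the v-closure is
    monotone.\<close>
  have "ideal_prod (K\<lparr>carrier := D\<rparr>) D I \<subseteq> I"
    using R.ideal_prod_inter[OF R.oneideal I] by simp
  then have "I [^]\<^bsub>ideals_set (K\<lparr>carrier := D\<rparr>)\<^esub> (1::nat) \<subseteq> I"
    by (simp add: ideals_set_def nat_pow_def)
  then have "v_closure K D (I [^]\<^bsub>ideals_set (K\<lparr>carrier := D\<rparr>)\<^esub> (1::nat)) \<subseteq> v_closure K D I"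
    unfolding v_closure_def frac_inverse_def by blast
  moreover have "r \<in> v_closure K D (I [^]\<^bsub>ideals_set (K\<lparr>carrier := D\<rparr>)\<^esub> (1::nat))"
    using r by (rule INT_D) simp
  ultimately have "r \<in> D" using v by blast
  moreover have "x \<in> carrier K" using x(1) by (simp add: frac_inverse_def)
  ultimately show "r \<in> {\<zero>}"
    using assms(1) rx x(2) unfolding completely_integrally_closed_def by blast
next
  fix r assume "r \<in> {\<zero>}"
  then show "r \<in> (\<Inter>n\<in>{1::nat..}. v_closure K D (I [^]\<^bsub>ideals_set (K\<lparr>carrier := D\<rparr>)\<^esub> n))"
    using D_closed(2) by (auto simp: v_closure_def frac_inverse_def)
qed

lemma archimedean_if_completely_integrally_closed:
  assumes "completely_integrally_closed K D"
  shows "archimedean_ring (K\<lparr>carrier := D\<rparr>)"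
  unfolding archimedean_ring_def
proof (intro ballI equalityI subsetI)
  fix x r
  assume x: "x \<in> carrier (K\<lparr>carrier := D\<rparr>) - Units (K\<lparr>carrier := D\<rparr>)"
    and r: "r \<in> (\<Inter>n\<in>{1::nat..}. PIdl\<^bsub>K\<lparr>carrier := D\<rparr>\<^esub> (x [^]\<^bsub>K\<lparr>carrier := D\<rparr>\<^esub> n))"
  have xD: "x \<in> D" "x \<in> carrier K" using x D_closed(1) by auto
  \<comment> \<open>Powers in the subring agree with powers in \<open>K\<close>, so membership in
    the principal ideals becomes divisibility, written with the operations of
    \<open>K\<close>.\<close>
  have multiple: "\<exists>d\<in>D. r = d \<otimes> x [^] n" if "n \<ge> 1" for n :: nat
    using r that nat_pow_consistent[of x n D] by (auto simp: cgenideal_def)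
  obtain d where d: "d \<in> D" "r = d \<otimes> x"
    using multiple[of 1] xD by auto
  show "r \<in> {\<zero>\<^bsub>K\<lparr>carrier := D\<rparr>\<^esub>}"
  \<comment> \<open>Zero is a nonunit without an inverse in \<open>K\<close>; there the case
    \<open>n = 1\<close> already forces \<open>r = \<zero>\<close>.\<close>
  proof (cases "x = \<zero>")
    case True
    then show ?thesis using d D_closed(1) by simp
  next
    case False
    then have inv: "inv x \<in> carrier K" "x \<otimes> inv x = \<one>" "inv x \<otimes> x = \<one>"
      using xD field_Units by auto
    \<comment> \<open>An inverse lying in \<open>D\<close> would make \<open>x\<close> a unit of
      \<open>D\<close>.\<close>
    have "inv x \<notin> D"
      using x inv xD by (auto simp: Units_def)
    moreover have "r \<otimes> inv x [^] n \<in> D" if "n \<ge> 1" for n :: nat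
    proof -
      obtain e where e: "e \<in> D" "r = e \<otimes> x [^] n" using multiple[OF \<open>n \<ge> 1\<close>] by blast
      \<comment> \<open>Cancelling \<open>x [^] n\<close> leaves the cofactor \<open>e\<close>,
        which lies in \<open>D\<close>.\<close>
      have "x [^] n \<otimes> inv x [^] n = \<one>"
        using pow_mult_distrib[of x "inv x" n] inv xD by (simp add: m_comm)
      then have "r \<otimes> inv x [^] n = e"
        using e D_closed(1) inv xD by (simp add: m_assoc)
      then show ?thesis using e by simp
    qed
    moreover have "r \<in> D" using d xD D_closed(4) by simp
    ultimately have "r = \<zero>"
      using assms inv(1) unfolding completely_integrally_closed_def by blast
    then show ?thesis by simp
  qed
next
  fix x r
  assume x: "x \<in> carrier (K\<lparr>carrier := D\<rparr>) - Units (K\<lparr>carrier := D\<rparr>)"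
    and r: "r \<in> {\<zero>\<^bsub>K\<lparr>carrier := D\<rparr>\<^esub>}"
  have "\<exists>d\<in>D. \<zero> = d \<otimes> x [^] n" for n :: nat
    using x D_closed(1,2) by (intro bexI[of _ \<zero>]) auto
  then show "r \<in> (\<Inter>n\<in>{1::nat..}. PIdl\<^bsub>K\<lparr>carrier := D\<rparr>\<^esub> (x [^]\<^bsub>K\<lparr>carrier := D\<rparr>\<^esub> n))"
    using r nat_pow_consistent[of x _ D] by (auto simp: cgenideal_def)
qed

end

theorem corollary2p4:
  fixes K :: "('a, 'b) ring_scheme" and D :: "'a set"
  assumes "quotient_field D K"
    and "completely_integrally_closed K D"
  shows "(\<forall>I. ideal I (K\<lparr>carrier := D\<rparr>) \<longrightarrow> I \<noteq> {\<zero>\<^bsub>K\<^esub>} \<longrightarrow> v_closure K D I \<subset> D \<longrightarrow>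
            (\<Inter>n\<in>{1::nat..}. v_closure K D (I [^]\<^bsub>ideals_set (K\<lparr>carrier := D\<rparr>)\<^esub> n)) = {\<zero>\<^bsub>K\<^esub>})
         \<and> archimedean_ring (K\<lparr>carrier := D\<rparr>)"
proof (intro conjI allI impI)
  interpret quotient_field D K by (rule assms(1))
  show "archimedean_ring (K\<lparr>carrier := D\<rparr>)"
    using assms(2) by (rule archimedean_if_completely_integrally_closed)
  fix I
  assume "ideal I (K\<lparr>carrier := D\<rparr>)" "v_closure K D I \<subset> D"
  then show "(\<Inter>n\<in>{1::nat..}. v_closure K D (I [^]\<^bsub>ideals_set (K\<lparr>carrier := D\<rparr>)\<^esub> n)) = {\<zero>\<^bsub>K\<^esub>}"
    by (rule Inter_v_closure_pow_eq_zero[OF assms(2)])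
qed

end
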